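(* Let $C$ be a commutative unital ring in which $2$ is invertible, and let $S$ be the free supercommutative algebra over $C$. Then the ideal of identities $\operatorname{id}(S)$ is generated as a T-ideal by the Grassmann identity $[x,[y,z]]=0$.
   Context: Algebras are associative, not necessarily unital; $[a,b]=ab-ba$. $C\langle X\rangle$ is the free associative $C$-algebra on a countably infinite alphabet $X$. For a $C$-algebra $B$, $\operatorname{id}(B)\subseteq C\langle X\rangle$ is the set of all $f(x_1,\dots,x_n)\in C\langle X\rangle$ such that $f(b_1,\dots,b_n)=0$ for all $b_1,\dots,b_n\in B$. A T-ideal is a two-sided ideal of $C\langle X\rangle$ stable under all endomorphisms of $C\langle X\rangle$; the T-ideal generated by $[x,[y,z]]$ (with $x,y,z$ distinct letters of $X$) is the smallest T-ideal containing it. A superalgebra is a $\mathbb{Z}/2\mathbb{Z}$-graded algebra $A=A_0\oplus A_1$; for homogeneous $x,y$ the supercommutator is $\{x,y\}=xy-(-1)^{|x||y|}yx$, extended bilinearly. The free supercommutative algebra $S$ over $C$ is the (unital) superalgebra generated by countably many even generators $y_1,y_2,\dots$ and countably many odd generators $z_1,z_2,\dots$, whose only relations are $\{a,b\}=0$ for all $a,b\in S$. The identities in $\operatorname{id}(S)$ are ordinary (non-graded) polynomial identities. *)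

theory Defs
  imports Complex_Main "HOL-Library.Poly_Mapping"
begin

section \<open>Associative algebras\<close>

text \<open>
  An associative algebra, not necessarily unital, is a type of class \<^class>\<open>ring\<close> together with
  a scalar multiplication by the commutative ring.
\<close>

locale assoc_algebra = module scale
  for scale :: "'c::comm_ring_1 \<Rightarrow> 'a::ring \<Rightarrow> 'a" +
  assumes scale_mult_left: "scale c (x * y) = scale c x * y"
    and scale_mult_right: "scale c (x * y) = x * scale c y"

locale algebra_hom = module_hom s1 s2 f + A: assoc_algebra s1 + B: assoc_algebra s2
  for s1 :: "'c::comm_ring_1 \<Rightarrow> 'a::ring \<Rightarrow> 'a"
    and s2 :: "'c \<Rightarrow> 'b::ring \<Rightarrow> 'b"
    and f :: "'a \<Rightarrow> 'b" +
  assumes mult: "f (x * y) = f x * f y"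

definition algebra_ideal :: "('c::comm_ring_1 \<Rightarrow> 'a::ring \<Rightarrow> 'a) \<Rightarrow> 'a set \<Rightarrow> bool" where
  "algebra_ideal scale I \<longleftrightarrow>
     module.subspace scale I \<and> (\<forall>a. \<forall>x\<in>I. a * x \<in> I \<and> x * a \<in> I)"

definition commutator :: "'a::ring \<Rightarrow> 'a \<Rightarrow> 'a" where
  "commutator a b = a * b - b * a"


section \<open>Free algebras\<close>

datatype 'x word = Word (letters: "'x list")

instantiation word :: (type) monoid_add
begin

definition zero_word :: "'a word" where
  "0 = Word []"

definition plus_word :: "'a word \<Rightarrow> 'a word \<Rightarrow> 'a word" where
  "u + v = Word (letters u @ letters v)"

instance
  by standard (auto simp: zero_word_def plus_word_def)

end

text \<open>
  With words added by concatenation, the convolution product makes \<^typ>\<open>'x word \<Rightarrow>\<^sub>0 'c\<close> the free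
  \<^emph>\<open>unital\<close> algebra on \<^typ>\<open>'x\<close>.
\<close>

definition scale_pm :: "'c::comm_ring_1 \<Rightarrow> ('x word \<Rightarrow>\<^sub>0 'c) \<Rightarrow> 'x word \<Rightarrow>\<^sub>0 'c" where
  "scale_pm c = Poly_Mapping.map ((*) c)"

lemma lookup_scale_pm [simp]:
  "Poly_Mapping.lookup (scale_pm c f) w = c * Poly_Mapping.lookup f w"
  by (simp add: scale_pm_def Poly_Mapping.map.rep_eq when_def)

lemma scale_pm_conv_mult: "scale_pm c f = Poly_Mapping.single 0 c * f"
  by (simp add: scale_pm_def mult_map_scale_conv_mult)

lemma mult_single_0_commute:
  fixes f :: "'x word \<Rightarrow>\<^sub>0 'c::comm_ring_1"
  shows "f * Poly_Mapping.single 0 c = Poly_Mapping.single 0 c * f"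
proof (induction f rule: Poly_Mapping.update_induct)
  case const
  show ?case by simp
next
  case (update f a b)
  have "Poly_Mapping.update a b f = f + Poly_Mapping.single a b"
    using update.hyps
    by (intro poly_mapping_eqI)
      (auto simp: lookup_update lookup_add lookup_single when_def in_keys_iff)
  with update.IH show ?case
    by (simp add: distrib_left distrib_right mult_single mult.commute)
qed

lemma lookup_mult_0:
  fixes f g :: "'x word \<Rightarrow>\<^sub>0 'c::comm_ring_1"
  shows "Poly_Mapping.lookup (f * g) 0 = Poly_Mapping.lookup f 0 * Poly_Mapping.lookup g 0"
proof -
  have eq0: "0 = u + v \<longleftrightarrow> u = 0 \<and> v = 0" for u v :: "'x word"
    by (cases u; cases v) (auto simp: zero_word_def plus_word_def)
  have "(\<Sum>v. Poly_Mapping.lookup g v when 0 = u + v) = (Poly_Mapping.lookup g 0 when u = 0)" for u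
  proof (cases "u = 0")
    case True
    then have "(\<lambda>v. Poly_Mapping.lookup g v when 0 = u + v)
        = (\<lambda>v. Poly_Mapping.lookup g v when v = 0)"
      by (simp add: eq0)
    then show ?thesis using True by simp
  next
    case False
    then show ?thesis by (simp add: eq0)
  qed
  then show ?thesis
    by (simp add: lookup_mult mult_when)
qed

interpretation free_unital: assoc_algebra "scale_pm :: 'c::comm_ring_1 \<Rightarrow> ('x word \<Rightarrow>\<^sub>0 'c) \<Rightarrow> _"
proof
  fix c d :: 'c and f g :: "'x word \<Rightarrow>\<^sub>0 'c"
  show "scale_pm c (f + g) = scale_pm c f + scale_pm c g"
    by (simp add: scale_pm_conv_mult distrib_left)
  show "scale_pm (c + d) f = scale_pm c f + scale_pm d f"
    by (simp add: scale_pm_conv_mult single_add distrib_right)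
  show "scale_pm c (scale_pm d f) = scale_pm (c * d) f"
    by (simp add: scale_pm_conv_mult mult_single flip: mult.assoc)
  show "scale_pm 1 f = f"
    by (simp add: scale_pm_conv_mult)
  show "scale_pm c (f * g) = scale_pm c f * g"
    by (simp add: scale_pm_conv_mult mult.assoc)
  show "scale_pm c (f * g) = f * scale_pm c g"
    by (simp add: scale_pm_conv_mult mult_single_0_commute flip: mult.assoc)
qed

text \<open>
  Algebras are not assumed to be unital, so the free algebra consists of the noncommutative
  polynomials without constant term; only these can be evaluated in an arbitrary algebra.
\<close>

typedef (overloaded) ('x, 'c) free_algebra =
  "{f :: 'x word \<Rightarrow>\<^sub>0 'c::comm_ring_1. Poly_Mapping.lookup f 0 = 0}"
  morphisms poly_of Free
  by (rule exI[of _ 0]) simp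

setup_lifting type_definition_free_algebra

instantiation free_algebra :: (type, comm_ring_1) ring
begin

lift_definition zero_free_algebra :: "('a, 'b) free_algebra" is 0 by simp

lift_definition plus_free_algebra ::
  "('a, 'b) free_algebra \<Rightarrow> ('a, 'b) free_algebra \<Rightarrow> ('a, 'b) free_algebra" is "(+)"
  by (simp add: lookup_add)

lift_definition minus_free_algebra ::
  "('a, 'b) free_algebra \<Rightarrow> ('a, 'b) free_algebra \<Rightarrow> ('a, 'b) free_algebra" is "(-)"
  by (simp add: lookup_minus)

lift_definition uminus_free_algebra ::
  "('a, 'b) free_algebra \<Rightarrow> ('a, 'b) free_algebra" is uminus
  by simp

lift_definition times_free_algebra ::
  "('a, 'b) free_algebra \<Rightarrow> ('a, 'b) free_algebra \<Rightarrow> ('a, 'b) free_algebra" is "(*)"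
  by (simp add: lookup_mult_0)

instance
  by standard
    (transfer; simp add: add.assoc add.commute mult.assoc distrib_left distrib_right; fail)+

end

lift_definition scale_free ::
  "'c::comm_ring_1 \<Rightarrow> ('x, 'c) free_algebra \<Rightarrow> ('x, 'c) free_algebra" is scale_pm
  by simp

lift_definition letter :: "'x \<Rightarrow> ('x, 'c::comm_ring_1) free_algebra" is
  "\<lambda>x. Poly_Mapping.single (Word [x]) 1"
  by (simp add: lookup_single zero_word_def)

interpretation free_algebra:
  assoc_algebra "scale_free :: 'c::comm_ring_1 \<Rightarrow> ('x, 'c) free_algebra \<Rightarrow> _"
proof
  fix c d :: 'c and a b :: "('x, 'c) free_algebra"
  show "scale_free c (a + b) = scale_free c a + scale_free c b"
    by transfer (rule free_unital.scale_right_distrib)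
  show "scale_free (c + d) a = scale_free c a + scale_free d a"
    by transfer (rule free_unital.scale_left_distrib)
  show "scale_free c (scale_free d a) = scale_free (c * d) a"
    by transfer (rule free_unital.scale_scale)
  show "scale_free 1 a = a"
    by transfer (rule free_unital.scale_one)
  show "scale_free c (a * b) = scale_free c a * b"
    by transfer (rule free_unital.scale_mult_left)
  show "scale_free c (a * b) = a * scale_free c b"
    by transfer (rule free_unital.scale_mult_right)
qed


section \<open>Polynomial identities and T-ideals\<close>

text \<open>
  The value of a nonempty product of letters; the empty word never occurs in an element of
  \<^typ>\<open>('x, 'c::comm_ring_1) free_algebra\<close>, and its value is arbitrary.
\<close>

fun word_value :: "('x \<Rightarrow> 'b::ring) \<Rightarrow> 'x list \<Rightarrow> 'b" where
  "word_value b [] = 0"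
| "word_value b [x] = b x"
| "word_value b (x # y # w) = b x * word_value b (y # w)"

definition evaluate ::
  "('c::comm_ring_1 \<Rightarrow> 'b::ring \<Rightarrow> 'b) \<Rightarrow> ('x \<Rightarrow> 'b) \<Rightarrow> ('x, 'c) free_algebra \<Rightarrow> 'b" where
  "evaluate scale b f =
     (\<Sum>w\<in>Poly_Mapping.keys (poly_of f).
        scale (Poly_Mapping.lookup (poly_of f) w) (word_value b (letters w)))"

definition identities ::
  "('c::comm_ring_1 \<Rightarrow> 'b::ring \<Rightarrow> 'b) \<Rightarrow> (nat, 'c) free_algebra set" where
  "identities scale = {f. \<forall>b. evaluate scale b f = 0}"

definition T_ideal :: "(nat, 'c::comm_ring_1) free_algebra set \<Rightarrow> bool" where
  "T_ideal I \<longleftrightarrow> algebra_ideal scale_free I \<and>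
     (\<forall>\<phi>. algebra_hom scale_free scale_free \<phi> \<longrightarrow> \<phi> ` I \<subseteq> I)"


section \<open>The free supercommutative algebra\<close>

text \<open>
  The free unital superalgebra has the even generators \<^term>\<open>Inl i\<close> and the odd generators
  \<^term>\<open>Inr i\<close>.  Degrees are represented by \<^term>\<open>0::nat\<close> and \<^term>\<open>1::nat\<close>.
\<close>

definition parity :: "(nat + nat) word \<Rightarrow> nat" where
  "parity w = length (filter (\<lambda>x. \<not> isl x) (letters w)) mod 2"

lemma parity_0: "parity 0 = 0"
  by (simp add: parity_def zero_word_def)

lift_definition component ::
  "nat \<Rightarrow> ((nat + nat) word \<Rightarrow>\<^sub>0 'c::comm_ring_1) \<Rightarrow> (nat + nat) word \<Rightarrow>\<^sub>0 'c" is
  "\<lambda>i f w. if parity w = i then f w else 0"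
  by (rule finite_subset[rotated]) auto

definition supercommutator ::
  "((nat + nat) word \<Rightarrow>\<^sub>0 'c::comm_ring_1) \<Rightarrow> ((nat + nat) word \<Rightarrow>\<^sub>0 'c) \<Rightarrow> (nat + nat) word \<Rightarrow>\<^sub>0 'c"
  where
  "supercommutator a b =
     (\<Sum>i\<in>{0,1}. \<Sum>j\<in>{0,1}.
        component i a * component j b - (-1) ^ (i * j) * (component j b * component i a))"

lemma component_decomposition: "component 0 a + component 1 a = a"
proof (rule poly_mapping_eqI)
  fix w
  have "parity w = 0 \<or> parity w = 1" by (auto simp: parity_def)
  then show "Poly_Mapping.lookup (component 0 a + component 1 a) w = Poly_Mapping.lookup a w"
    by (auto simp: lookup_add component.rep_eq)
qed

lemma component_component: "component i (component j a) = (if i = j then component j a else 0)"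
  by (rule poly_mapping_eqI) (auto simp: component.rep_eq)

lemma supercommutator_homogeneous:
  assumes "component i a = a" "component j b = b" "i < 2" "j < 2"
  shows "supercommutator a b = a * b - (-1) ^ (i * j) * (b * a)"
proof -
  have "component k a = (if k = i then a else 0)" "component k b = (if k = j then b else 0)" for k
    using component_component[of k i a] component_component[of k j b] assms by auto
  moreover have "i = 0 \<or> i = 1" "j = 0 \<or> j = 1"
    using assms by auto
  ultimately show ?thesis
    by (auto simp: supercommutator_def)
qed

text \<open>
  The supercommutators of all elements of the free superalgebra map onto those of the quotient,
  whose grading is the induced one; so the relations \<open>{a, b} = 0\<close> for all elements \<open>a, b\<close> of
  the quotient amount to factoring out the following ideal.
\<close>

definition supercomm_ideal :: "((nat + nat) word \<Rightarrow>\<^sub>0 'c::comm_ring_1) set" where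
  "supercomm_ideal = algebra_ideal scale_pm hull {supercommutator a b | a b. True}"

lemma algebra_ideal_supercomm_ideal: "algebra_ideal scale_pm supercomm_ideal"
  unfolding supercomm_ideal_def
  by (rule hull_in) (auto simp: algebra_ideal_def free_unital.subspace_def)

lemma supercomm_ideal_0: "0 \<in> supercomm_ideal"
  and supercomm_ideal_add:
    "f \<in> supercomm_ideal \<Longrightarrow> g \<in> supercomm_ideal \<Longrightarrow> f + g \<in> supercomm_ideal"
  and supercomm_ideal_scale: "f \<in> supercomm_ideal \<Longrightarrow> scale_pm c f \<in> supercomm_ideal"
  and supercomm_ideal_mult_left: "f \<in> supercomm_ideal \<Longrightarrow> h * f \<in> supercomm_ideal"
  and supercomm_ideal_mult_right: "f \<in> supercomm_ideal \<Longrightarrow> f * h \<in> supercomm_ideal"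
  using algebra_ideal_supercomm_ideal
  by (auto simp: algebra_ideal_def free_unital.subspace_def)

lemma supercomm_ideal_uminus: "f \<in> supercomm_ideal \<Longrightarrow> - f \<in> supercomm_ideal"
  using supercomm_ideal_mult_left[of f "-1"] by simp

lemma supercomm_ideal_diff:
  "f \<in> supercomm_ideal \<Longrightarrow> g \<in> supercomm_ideal \<Longrightarrow> f - g \<in> supercomm_ideal"
  using supercomm_ideal_add[OF _ supercomm_ideal_uminus, of f g] by simp

lemma supercomm_ideal_constant_term:
  assumes "f \<in> supercomm_ideal"
  shows "Poly_Mapping.lookup f 0 = 0"
proof -
  let ?K = "{f :: (nat + nat) word \<Rightarrow>\<^sub>0 'a. Poly_Mapping.lookup f 0 = 0}"
  have "algebra_ideal scale_pm ?K"
    by (auto simp: algebra_ideal_def free_unital.subspace_def lookup_add lookup_mult_0)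
  moreover have "supercommutator a b \<in> ?K" for a b :: "(nat + nat) word \<Rightarrow>\<^sub>0 'a"
    by (simp add: supercommutator_def lookup_add lookup_minus lookup_mult_0 component.rep_eq
        parity_0 mult.commute)
  ultimately have "supercomm_ideal \<subseteq> ?K"
    unfolding supercomm_ideal_def by (intro hull_minimal) auto
  with assms show ?thesis by blast
qed

quotient_type (overloaded) 'c free_supercomm =
  "(nat + nat) word \<Rightarrow>\<^sub>0 'c::comm_ring_1" / "\<lambda>f g. f - g \<in> supercomm_ideal"
proof (rule equivpI)
  show "reflp (\<lambda>f g :: (nat + nat) word \<Rightarrow>\<^sub>0 'c. f - g \<in> supercomm_ideal)"
    by (simp add: reflp_def supercomm_ideal_0)
  show "symp (\<lambda>f g :: (nat + nat) word \<Rightarrow>\<^sub>0 'c. f - g \<in> supercomm_ideal)"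
    by (auto simp: symp_def dest: supercomm_ideal_uminus)
  show "transp (\<lambda>f g :: (nat + nat) word \<Rightarrow>\<^sub>0 'c. f - g \<in> supercomm_ideal)"
    by (auto simp: transp_def dest: supercomm_ideal_add)
qed

instantiation free_supercomm :: (comm_ring_1) ring_1
begin

lift_definition zero_free_supercomm :: "'a free_supercomm" is 0 .

lift_definition one_free_supercomm :: "'a free_supercomm" is 1 .

lift_definition plus_free_supercomm ::
  "'a free_supercomm \<Rightarrow> 'a free_supercomm \<Rightarrow> 'a free_supercomm" is "(+)"
  using supercomm_ideal_add by (metis add_diff_add)

lift_definition minus_free_supercomm ::
  "'a free_supercomm \<Rightarrow> 'a free_supercomm \<Rightarrow> 'a free_supercomm" is "(-)"
  subgoal for f f' g g'
    using supercomm_ideal_diff[of "f - f'" "g - g'"] by (simp add: algebra_simps)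
  done

lift_definition uminus_free_supercomm :: "'a free_supercomm \<Rightarrow> 'a free_supercomm" is uminus
  subgoal for f f'
    using supercomm_ideal_uminus[of "f - f'"] by simp
  done

lift_definition times_free_supercomm ::
  "'a free_supercomm \<Rightarrow> 'a free_supercomm \<Rightarrow> 'a free_supercomm" is "(*)"
  subgoal for f f' g g'
    using supercomm_ideal_add[OF supercomm_ideal_mult_right[of "f - f'" g]
        supercomm_ideal_mult_left[of "g - g'" f']]
    by (simp add: algebra_simps)
  done

instance
proof
  fix a b c :: "'a free_supercomm"
  show "a + b + c = a + (b + c)"
    by transfer (simp add: add.assoc supercomm_ideal_0)
  show "a + b = b + a"
    by transfer (simp add: add.commute supercomm_ideal_0)
  show "0 + a = a"
    by transfer (simp add: supercomm_ideal_0)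
  show "- a + a = 0"
    by transfer (simp add: supercomm_ideal_0)
  show "a - b = a + - b"
    by transfer (simp add: supercomm_ideal_0)
  show "a * b * c = a * (b * c)"
    by transfer (simp add: mult.assoc supercomm_ideal_0)
  show "(a + b) * c = a * c + b * c"
    by transfer (simp add: distrib_right supercomm_ideal_0)
  show "a * (b + c) = a * b + a * c"
    by transfer (simp add: distrib_left supercomm_ideal_0)
  show "1 * a = a"
    by transfer (simp add: supercomm_ideal_0)
  show "a * 1 = a"
    by transfer (simp add: supercomm_ideal_0)
  show "(0 :: 'a free_supercomm) \<noteq> 1"
  proof transfer
    show "(0 :: (nat + nat) word \<Rightarrow>\<^sub>0 'a) - 1 \<notin> supercomm_ideal"
      using supercomm_ideal_constant_term[of "0 - 1 :: (nat + nat) word \<Rightarrow>\<^sub>0 'a"]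
      by (auto simp: lookup_minus lookup_one)
  qed
qed

end

lift_definition scale_supercomm ::
  "'c::comm_ring_1 \<Rightarrow> 'c free_supercomm \<Rightarrow> 'c free_supercomm" is scale_pm
  subgoal for c f f'
    using supercomm_ideal_scale[of "f - f'" c] by (simp only: free_unital.scale_right_diff_distrib)
  done

interpretation free_supercomm:
  assoc_algebra "scale_supercomm :: 'c::comm_ring_1 \<Rightarrow> 'c free_supercomm \<Rightarrow> _"
proof
  fix c d :: 'c and a b :: "'c free_supercomm"
  show "scale_supercomm c (a + b) = scale_supercomm c a + scale_supercomm c b"
    by transfer (simp add: free_unital.scale_right_distrib supercomm_ideal_0)
  show "scale_supercomm (c + d) a = scale_supercomm c a + scale_supercomm d a"
    by transfer (simp add: free_unital.scale_left_distrib supercomm_ideal_0)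
  show "scale_supercomm c (scale_supercomm d a) = scale_supercomm (c * d) a"
    by transfer (simp add: supercomm_ideal_0)
  show "scale_supercomm 1 a = a"
    by transfer (simp add: supercomm_ideal_0)
  show "scale_supercomm c (a * b) = scale_supercomm c a * b"
    by transfer (simp add: free_unital.scale_mult_left supercomm_ideal_0)
  show "scale_supercomm c (a * b) = a * scale_supercomm c b"
    by transfer (simp add: free_unital.scale_mult_right supercomm_ideal_0)
qed

end

theory Submission
  imports Defs
begin

text \<open>
  The free supercommutative algebra \<open>S\<close> satisfies the Grassmann identity because even elements are
  central and odd ones anticommute: the commutator of \<open>b = b0 + b1\<close> and \<open>c = c0 + c1\<close> is
  \<open>2 b1 c1\<close>, which commutes with everything (\<open>grassmann_identity_free_supercomm\<close>).

  Conversely, every unital algebra \<open>A\<close> with \<open>1/2\<close> in which triple commutators vanish satisfies all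
  identities of \<open>S\<close> (\<open>satisfies_identities_free_supercomm\<close>).  Two structures on such an \<open>A\<close> give
  this.  The Jordan product \<open>a \<circ> b = (a b + b a) / 2\<close> is commutative and associative, because its
  associator is a triple commutator.  The products \<open>[a1, a2] [a3, a4] \<dots>\<close> are central and
  antisymmetric in all the \<open>a i\<close>, because \<open>[a, b] [c, d] = - [a, c] [b, d]\<close>.  So elements
  \<open>b i\<close> of \<open>A\<close> define a linear map \<open>\<Psi>\<close> from \<open>S\<close> to \<open>A\<close>, like the quantization of even
  differential forms: even generators are multiplied by the Jordan product, consecutive pairs of
  odd generators become halved commutators, and odd elements go to \<open>0\<close>.  It is well defined on
  the quotient \<open>S\<close> by exactly the two facts above (\<open>quantize_supercomm_ideal\<close>).  Moreover, it
  inverts the substitution \<open>x i \<mapsto> y i + z i\<close>, that is,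
  \<open>\<Psi> ((y i + z i) (y j + z j) \<dots>) = b i b j \<dots>\<close> (\<open>quantize_generic_product\<close>): the identity
  \<open>a b = a \<circ> b + [a, b] / 2\<close> moves one letter at a time across \<open>\<Psi>\<close>.  If \<open>f\<close> is an identity
  of \<open>S\<close>, then it vanishes at the elements \<open>y i + z i\<close>, and applying \<open>\<Psi>\<close> shows that \<open>f\<close>
  vanishes at the \<open>b i\<close>.

  This is applied to the quotient of the free unital algebra by the ideal of all triple
  commutators, with the letters as the \<open>b i\<close>.  Since scalars are central, that ideal consists of
  elements of the T-ideal (\<open>grassmann_ideal_subset_poly_of_image\<close>).
\<close>

section \<open>Linear extension and evaluation\<close>

definition linear_extension ::
  "('c::comm_ring_1 \<Rightarrow> 'b::ab_group_add \<Rightarrow> 'b) \<Rightarrow> ('w \<Rightarrow> 'b) \<Rightarrow> ('w \<Rightarrow>\<^sub>0 'c) \<Rightarrow> 'b" where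
  "linear_extension scale g f =
     (\<Sum>w\<in>Poly_Mapping.keys f. scale (Poly_Mapping.lookup f w) (g w))"

lemma sum_monomials:
  "(\<Sum>w\<in>Poly_Mapping.keys f. Poly_Mapping.single w (Poly_Mapping.lookup f w)) = f"
  by (rule poly_mapping_eqI) (simp add: lookup_sum lookup_single when_def in_keys_iff)

lemma poly_mapping_additive_induct [case_names zero single add]:
  assumes "P 0" and "\<And>w c. P (Poly_Mapping.single w c)"
    and "\<And>f g. P f \<Longrightarrow> P g \<Longrightarrow> P (f + g)"
  shows "P (f :: 'w \<Rightarrow>\<^sub>0 'c::comm_monoid_add)"
proof -
  have "P (\<Sum>w\<in>W. Poly_Mapping.single w (Poly_Mapping.lookup f w))" if "finite W" for W
    using that by (induction W rule: finite_induct) (simp_all add: assms)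
  from this[OF finite_keys[of f]] show ?thesis
    by (simp add: sum_monomials)
qed

context assoc_algebra
begin

lemma linear_extension_superset:
  assumes "finite W" and "Poly_Mapping.keys f \<subseteq> W"
  shows "linear_extension scale g f = (\<Sum>w\<in>W. scale (Poly_Mapping.lookup f w) (g w))"
  unfolding linear_extension_def
  using assms by (intro sum.mono_neutral_left) (auto simp: in_keys_iff)

lemma linear_extension_zero [simp]: "linear_extension scale g 0 = 0"
  by (simp add: linear_extension_def)

lemma linear_extension_single [simp]:
  "linear_extension scale g (Poly_Mapping.single w c) = scale c (g w)"
  by (subst linear_extension_superset[of "{w}"]) auto

lemma linear_extension_add [simp]:
  "linear_extension scale g (f1 + f2) = linear_extension scale g f1 + linear_extension scale g f2"
proof -
  let ?W = "Poly_Mapping.keys f1 \<union> Poly_Mapping.keys f2"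
  have "Poly_Mapping.keys (f1 + f2) \<subseteq> ?W"
    by (rule Poly_Mapping.keys_add)
  then show ?thesis
    by (simp add: linear_extension_superset[of ?W] lookup_add scale_left_distrib sum.distrib)
qed

lemma linear_extension_uminus [simp]:
  "linear_extension scale g (- f) = - linear_extension scale g f"
  using linear_extension_add[of g f "- f"] by (simp add: minus_unique)

lemma linear_extension_diff [simp]:
  "linear_extension scale g (f1 - f2) = linear_extension scale g f1 - linear_extension scale g f2"
  using linear_extension_add[of g f1 "- f2"] by simp

lemma linear_extension_sum:
  "linear_extension scale g (\<Sum>i\<in>I. f i) = (\<Sum>i\<in>I. linear_extension scale g (f i))"
  by (induction I rule: infinite_finite_induct) auto

lemma linear_extension_scale [simp]:
  "linear_extension scale g (scale_pm c f) = scale c (linear_extension scale g f)"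
  by (induction f rule: poly_mapping_additive_induct)
    (simp_all add: free_unital.scale_right_distrib scale_right_distrib
      scale_pm_conv_mult[of _ "Poly_Mapping.single _ _"] mult_single)

lemma evaluate_eq_linear_extension:
  "evaluate scale b f = linear_extension scale (\<lambda>w. word_value b (letters w)) (poly_of f)"
  by (simp add: evaluate_def linear_extension_def)

lemma evaluate_letter [simp]: "evaluate scale b (letter x) = b x"
  by (simp add: evaluate_eq_linear_extension letter.rep_eq)

lemma word_value_append:
  "u \<noteq> [] \<Longrightarrow> v \<noteq> [] \<Longrightarrow> word_value b (u @ v) = word_value b u * word_value b v"
proof (induction b u rule: word_value.induct)
  case (2 b x)
  then show ?case by (cases v) auto
qed (auto simp: mult.assoc)

lemma evaluate_mult:
  fixes f g :: "('x, 'c) free_algebra"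
  shows "evaluate scale b (f * g) = evaluate scale b f * evaluate scale b g"
proof -
  let ?K = "\<lambda>f :: ('x, 'c) free_algebra. Poly_Mapping.keys (poly_of f)"
  let ?c = "\<lambda>f :: ('x, 'c) free_algebra. Poly_Mapping.lookup (poly_of f)"
  let ?m = "\<lambda>f u. Poly_Mapping.single u (?c f u)"
  \<comment> \<open>The empty word must be excluded: \<open>word_value\<close> is multiplicative on nonempty words only.\<close>
  have nonempty: "letters w \<noteq> []" if "w \<in> ?K f" for w f
    using that poly_of[of f] by (cases w) (auto simp: in_keys_iff zero_word_def)
  have "poly_of (f * g) = (\<Sum>u\<in>?K f. ?m f u) * (\<Sum>v\<in>?K g. ?m g v)"
    by (simp add: times_free_algebra.rep_eq sum_monomials)
  also have "\<dots> = (\<Sum>u\<in>?K f. \<Sum>v\<in>?K g. Poly_Mapping.single (u + v) (?c f u * ?c g v))"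
    by (simp add: sum_product mult_single)
  finally have "evaluate scale b (f * g) = (\<Sum>u\<in>?K f. \<Sum>v\<in>?K g.
      scale (?c f u * ?c g v) (word_value b (letters u @ letters v)))"
    by (simp add: evaluate_eq_linear_extension linear_extension_sum plus_word_def)
  also have "\<dots> = (\<Sum>u\<in>?K f. \<Sum>v\<in>?K g.
      scale (?c f u) (word_value b (letters u)) * scale (?c g v) (word_value b (letters v)))"
    by (intro sum.cong refl)
      (simp add: word_value_append nonempty mult.commute[of "?c g _"] flip: scale_mult_left scale_mult_right)
  also have "\<dots> = evaluate scale b f * evaluate scale b g"
    by (simp add: evaluate_def sum_product)
  finally show ?thesis .
qed

lemma algebra_hom_evaluate: "algebra_hom scale_free scale (evaluate scale b)"
proof unfold_locales
  show "evaluate scale b (f + g) = evaluate scale b f + evaluate scale b g" for f g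
    by (simp add: evaluate_eq_linear_extension plus_free_algebra.rep_eq)
  show "evaluate scale b (scale_free c f) = scale c (evaluate scale b f)" for c f
    by (simp add: evaluate_eq_linear_extension scale_free.rep_eq)
qed (rule evaluate_mult)

end

lemma (in algebra_hom) hom_evaluate: "f (evaluate s1 b p) = evaluate s2 (f \<circ> b) p"
proof -
  have "f (word_value b w) = word_value (f \<circ> b) w" for w
    by (induction b w rule: word_value.induct) (auto simp: mult)
  then show ?thesis
    by (simp add: evaluate_def sum scale)
qed

lemma (in algebra_hom) hom_commutator: "f (commutator a b) = commutator (f a) (f b)"
  by (simp add: commutator_def diff mult)

lemma algebra_hom_poly_of: "algebra_hom scale_free scale_pm poly_of"
  by unfold_locales
    (simp_all add: plus_free_algebra.rep_eq scale_free.rep_eq times_free_algebra.rep_eq)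

text \<open>
  Words are monomials in the letters, so evaluating at the letters gives back the polynomial.
  Together with \<open>hom_evaluate\<close> this says that a homomorphism on the free algebra is evaluation at
  the images of the letters.
\<close>

lemma poly_of_eq_evaluate: "evaluate scale_pm (poly_of \<circ> letter) f = poly_of f"
proof -
  have word: "word_value (poly_of \<circ> letter :: 'x \<Rightarrow> _ \<Rightarrow>\<^sub>0 'c::comm_ring_1) w
      = Poly_Mapping.single (Word w) 1" if "w \<noteq> []" for w :: "'x list"
    using that
    by (induction "poly_of \<circ> letter :: 'x \<Rightarrow> _ \<Rightarrow>\<^sub>0 'c" w rule: word_value.induct)
      (simp_all add: letter.rep_eq mult_single plus_word_def)
  have "evaluate scale_pm (poly_of \<circ> letter) f
      = (\<Sum>w\<in>Poly_Mapping.keys (poly_of f). Poly_Mapping.single w (Poly_Mapping.lookup (poly_of f) w))"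
    unfolding evaluate_def
  proof (intro sum.cong refl)
    fix w assume "w \<in> Poly_Mapping.keys (poly_of f)"
    then have "letters w \<noteq> []"
      using poly_of[of f] by (cases w) (auto simp: in_keys_iff zero_word_def)
    then show "scale_pm (Poly_Mapping.lookup (poly_of f) w)
          (word_value (poly_of \<circ> letter) (letters w))
        = Poly_Mapping.single w (Poly_Mapping.lookup (poly_of f) w)"
      by (simp add: word scale_pm_conv_mult mult_single)
  qed
  then show ?thesis
    by (simp add: sum_monomials)
qed

lemma evaluate_at_letters: "evaluate scale_free letter f = f"
  using algebra_hom.hom_evaluate[OF algebra_hom_poly_of, of letter f]
  by (simp add: poly_of_eq_evaluate poly_of_inject)

lemma (in assoc_algebra) T_ideal_identities: "T_ideal (identities scale)"
  unfolding T_ideal_def algebra_ideal_def free_algebra.subspace_def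
proof (intro conjI allI ballI impI)
  interpret ev: algebra_hom scale_free scale "evaluate scale b" for b
    by (rule algebra_hom_evaluate)
  show "0 \<in> identities scale"
    by (simp add: identities_def ev.zero)
  show "f + g \<in> identities scale" if "f \<in> identities scale" "g \<in> identities scale" for f g
    using that by (simp add: identities_def ev.add)
  show "scale_free c f \<in> identities scale" if "f \<in> identities scale" for c f
    using that by (simp add: identities_def ev.scale)
  show "a * f \<in> identities scale" "f * a \<in> identities scale" if "f \<in> identities scale" for a f
    using that by (simp_all add: identities_def ev.mult)
  show "\<phi> ` identities scale \<subseteq> identities scale" if "algebra_hom scale_free scale_free \<phi>" for \<phi>
  proof -
    interpret phi: algebra_hom scale_free scale_free \<phi> by (rule that)
    have "evaluate scale b (\<phi> f) = evaluate scale (evaluate scale b \<circ> (\<phi> \<circ> letter)) f" for b f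
      using phi.hom_evaluate[of letter f] ev.hom_evaluate[of b "\<phi> \<circ> letter" f]
      by (simp add: evaluate_at_letters)
    then show ?thesis
      by (auto simp: identities_def)
  qed
qed


section \<open>The Grassmann identity in the free supercommutative algebra\<close>

lemma algebra_hom_abs_free_supercomm:
  "algebra_hom scale_pm scale_supercomm abs_free_supercomm"
  by unfold_locales
    (simp_all add: plus_free_supercomm.abs_eq scale_supercomm.abs_eq times_free_supercomm.abs_eq)

lemma abs_free_supercomm_eq_0_iff: "abs_free_supercomm f = 0 \<longleftrightarrow> f \<in> supercomm_ideal"
  by (simp add: zero_free_supercomm_def free_supercomm.abs_eq_iff)

lemma component_zero [simp]: "component i 0 = 0"
  by (rule poly_mapping_eqI) (auto simp: component.rep_eq)

lemma component_add: "component i (f + g) = component i f + component i g"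
  by (rule poly_mapping_eqI) (auto simp: component.rep_eq lookup_add)

lemma component_single: "component (parity w) (Poly_Mapping.single w c) = Poly_Mapping.single w c"
  by (rule poly_mapping_eqI) (auto simp: component.rep_eq lookup_single when_def)

lemma supercommutator_zero [simp]: "supercommutator 0 f = 0" "supercommutator f 0 = 0"
  by (simp_all add: supercommutator_def)

lemma supercommutator_add:
  "supercommutator (f + g) h = supercommutator f h + supercommutator g h"
  "supercommutator h (f + g) = supercommutator h f + supercommutator h g"
  by (simp_all add: supercommutator_def component_add distrib_left distrib_right)

lemma supercommutator_in_supercomm_ideal: "supercommutator f g \<in> supercomm_ideal"
  unfolding supercomm_ideal_def by (rule hull_inc) auto

lemma abs_free_supercomm_supercommute:
  assumes "component i f = f" "component j g = g" "i < 2" "j < 2"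
  shows "abs_free_supercomm f * abs_free_supercomm g
    = abs_free_supercomm ((-1) ^ (i * j) * (g * f))"
proof -
  have "f * g - (-1) ^ (i * j) * (g * f) \<in> supercomm_ideal"
    using supercommutator_in_supercomm_ideal[of f g] supercommutator_homogeneous[OF assms] by simp
  then show ?thesis
    by (simp add: free_supercomm.abs_eq_iff times_free_supercomm.abs_eq)
qed

lemma even_commutes:
  "abs_free_supercomm (component 0 f) * s = s * abs_free_supercomm (component 0 f)"
proof -
  obtain g where s: "s = abs_free_supercomm g"
    by (induct s rule: free_supercomm.abs_induct) blast
  have "abs_free_supercomm (component 0 f) * abs_free_supercomm (component i g)
      = abs_free_supercomm (component i g) * abs_free_supercomm (component 0 f)" if "i < 2" for i
    using abs_free_supercomm_supercommute[of 0 "component 0 f" i "component i g"] that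
    by (simp add: component_component times_free_supercomm.abs_eq)
  from this[of 0] this[of 1]
  have "abs_free_supercomm (component 0 f) * t = t * abs_free_supercomm (component 0 f)"
    if "t = abs_free_supercomm (component 0 g) + abs_free_supercomm (component 1 g)" for t
    unfolding that distrib_left distrib_right by simp
  moreover have "s = abs_free_supercomm (component 0 g) + abs_free_supercomm (component 1 g)"
    unfolding s plus_free_supercomm.abs_eq component_decomposition ..
  ultimately show ?thesis by blast
qed

lemma odd_anticommute:
  "abs_free_supercomm (component 1 f) * abs_free_supercomm (component 1 g)
    = - (abs_free_supercomm (component 1 g) * abs_free_supercomm (component 1 f))"
  using abs_free_supercomm_supercommute[of 1 "component 1 f" 1 "component 1 g"]
  by (simp add: component_component times_free_supercomm.abs_eq uminus_free_supercomm.abs_eq)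

text \<open>
  Only the odd parts contribute to a commutator, and a product of two odd elements commutes with odd
  elements, because it passes them with two changes of sign, and with even ones, which are central.
\<close>

lemma grassmann_identity_free_supercomm:
  fixes a b c :: "'c::comm_ring_1 free_supercomm"
  shows "commutator a (commutator b c) = 0"
proof -
  have split: "\<exists>s0 s1. s = s0 + s1 \<and> s0 \<in> abs_free_supercomm ` range (component 0) \<and>
      s1 \<in> abs_free_supercomm ` range (component 1)" for s :: "'c free_supercomm"
  proof -
    obtain f where "s = abs_free_supercomm f"
      by (induct s rule: free_supercomm.abs_induct) blast
    then have "s = abs_free_supercomm (component 0 f) + abs_free_supercomm (component 1 f)"
      by (simp add: plus_free_supercomm.abs_eq component_decomposition del: One_nat_def)
    then show ?thesis by blast
  qed
  have even: "s0 * t = t * s0" if "s0 \<in> abs_free_supercomm ` range (component 0)"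
    for s0 t :: "'c free_supercomm"
    using that by (auto simp: even_commutes)
  have odd: "s1 * t1 = - (t1 * s1)"
    if "s1 \<in> abs_free_supercomm ` range (component 1)"
      and "t1 \<in> abs_free_supercomm ` range (component 1)"
    for s1 t1 :: "'c free_supercomm"
    using that odd_anticommute by blast
  obtain a0 a1 where a: "a = a0 + a1" "a0 \<in> abs_free_supercomm ` range (component 0)"
    "a1 \<in> abs_free_supercomm ` range (component 1)"
    using split by metis
  obtain b0 b1 where b: "b = b0 + b1" "b0 \<in> abs_free_supercomm ` range (component 0)"
    "b1 \<in> abs_free_supercomm ` range (component 1)"
    using split by metis
  obtain c0 c1 where c: "c = c0 + c1" "c0 \<in> abs_free_supercomm ` range (component 0)"
    "c1 \<in> abs_free_supercomm ` range (component 1)"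
    using split by metis
  have "commutator b c
      = (b0 * c0 - c0 * b0) + (b0 * c1 - c1 * b0) + (b1 * c0 - c0 * b1) + (b1 * c1 - c1 * b1)"
    by (simp add: commutator_def b(1) c(1) algebra_simps)
  also have "\<dots> = b1 * c1 + b1 * c1"
    unfolding even[OF b(2), of c0] even[OF b(2), of c1] even[OF c(2), of b1] odd[OF c(3) b(3)]
    by simp
  finally have bc: "commutator b c = b1 * c1 + b1 * c1" .
  have "a1 * (b1 * c1) = (a1 * b1) * c1"
    by (rule mult.assoc[symmetric])
  also have "\<dots> = - (b1 * (a1 * c1))"
    unfolding odd[OF a(3) b(3)] by (simp add: mult.assoc)
  also have "\<dots> = b1 * c1 * a1"
    unfolding odd[OF a(3) c(3)] by (simp add: mult.assoc)
  finally have "a1 * (b1 * c1) = b1 * c1 * a1" .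
  then have "a * (b1 * c1) = b1 * c1 * a"
    unfolding a(1) distrib_left distrib_right even[OF a(2), of "b1 * c1"] by simp
  then show ?thesis
    unfolding bc by (simp add: commutator_def distrib_left distrib_right)
qed


section \<open>Grassmann algebras satisfy the identities of the free supercommutative algebra\<close>

abbreviation even_generator :: "nat \<Rightarrow> (nat + nat) word \<Rightarrow>\<^sub>0 'c::comm_ring_1" where
  "even_generator i \<equiv> Poly_Mapping.single (Word [Inl i]) 1"

abbreviation odd_generator :: "nat \<Rightarrow> (nat + nat) word \<Rightarrow>\<^sub>0 'c::comm_ring_1" where
  "odd_generator i \<equiv> Poly_Mapping.single (Word [Inr i]) 1"

text \<open>
  The unit serves as the value of the empty product of generators.
\<close>

locale grassmann_algebra = assoc_algebra scale
  for scale :: "'c::comm_ring_1 \<Rightarrow> 'a::{ring, monoid_mult} \<Rightarrow> 'a" +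
  fixes half :: 'c
  assumes half: "half + half = 1"
    and grassmann_identity: "commutator a (commutator b (c :: 'a)) = 0"
begin

lemma commutator_central: "commutator a b * c = c * commutator a (b :: 'a)"
  using grassmann_identity[of c a b] by (simp add: commutator_def)

lemma commutator_swap: "commutator b a = - commutator a b"
  by (simp add: commutator_def)

lemma commutator_mult_right: "commutator a (b * c) = commutator a b * c + b * commutator a c"
  by (simp add: commutator_def algebra_simps)

lemma commutator_add_right: "commutator a (b + c) = commutator a b + commutator a c"
  by (simp add: commutator_def algebra_simps)

text \<open>
  Expand the triple commutator \<open>[a, [d, b c]]\<close> by the Leibniz rule; the terms with a factor
  \<open>[a, [d, b]]\<close> or \<open>[a, [d, c]]\<close> vanish, and the other two are the two sides, up to sign.
\<close>

lemma commutator_exchange: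
  "commutator a b * commutator c d = - (commutator a c * commutator b (d :: 'a))"
proof -
  have "commutator a (commutator d (b * c))
      = commutator d b * commutator a c + commutator a b * commutator d c"
    by (simp add: commutator_mult_right commutator_add_right grassmann_identity)
  then have "commutator d b * commutator a c + commutator a b * commutator d c = 0"
    by (simp add: grassmann_identity)
  then have "commutator a c * commutator b d + commutator a b * commutator c d = 0"
    using commutator_swap[of b d] commutator_swap[of c d] commutator_central[of d b "commutator a c"]
    by (simp add: neg_eq_iff_add_eq_0 flip: minus_add_distrib)
  then show ?thesis
    by (simp add: eq_neg_iff_add_eq_0 add.commute)
qed

definition jordan :: "'a \<Rightarrow> 'a \<Rightarrow> 'a" where
  "jordan a b = scale half (a * b + b * a)"

lemma jordan_add_right: "jordan a (b + c) = jordan a b + jordan a c"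
  by (simp add: jordan_def algebra_simps flip: scale_right_distrib)

lemma jordan_zero_right [simp]: "jordan a 0 = 0"
  by (simp add: jordan_def)

lemma jordan_scale_right: "jordan a (scale c b) = scale c (jordan a b)"
  by (simp add: jordan_def mult.commute flip: scale_mult_left scale_mult_right scale_right_distrib)

lemma half_double: "scale half a + scale half a = a"
  by (simp add: half flip: scale_left_distrib)

lemma jordan_central:
  assumes "\<And>b. c * b = b * c"
  shows "jordan a c = a * c"
  using half_double[of "a * c"] by (simp add: jordan_def assms scale_right_distrib)

lemma jordan_mult_central:
  assumes "\<And>b. c * b = b * c"
  shows "jordan a (c * b) = c * jordan a b"
proof -
  have "a * (c * b) = c * (a * b)"
    by (metis assms mult.assoc)
  then show ?thesis
    by (simp add: jordan_def mult.assoc distrib_left flip: scale_mult_right)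
qed

text \<open>
  The commutator of the operators \<open>jordan a\<close> and \<open>jordan b\<close> is a quarter of
  \<open>[[a, b], _]\<close>.  With commutativity this makes the Jordan product associative.
\<close>

lemma jordan_left_commute: "jordan a (jordan b t) = jordan b (jordan a t)"
proof -
  have "a * (b * t + t * b) + (b * t + t * b) * a - (b * (a * t + t * a) + (a * t + t * a) * b)
      = commutator (commutator a b) t"
    by (simp add: commutator_def algebra_simps)
  also have "\<dots> = 0"
    by (subst commutator_swap) (simp add: grassmann_identity)
  finally have "a * (b * t + t * b) + (b * t + t * b) * a = b * (a * t + t * a) + (a * t + t * a) * b"
    by simp
  then show ?thesis
    by (simp add: jordan_def flip: scale_mult_left scale_mult_right scale_right_distrib)
qed

lemma jordan_add_commutator: "jordan a b + scale half (commutator a b) = a * b"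
proof -
  have "jordan a b + scale half (commutator a b) = scale half (a * b) + scale half (a * b)"
    by (simp add: jordan_def commutator_def algebra_simps flip: scale_right_distrib)
  then show ?thesis
    by (simp add: half_double)
qed

lemma half_commutator_central:
  "scale half (commutator a b) * t = t * scale half (commutator a (b :: 'a))"
  by (simp add: commutator_central flip: scale_mult_left scale_mult_right)

text \<open>
  The image of a product of odd generators.  The value \<open>0\<close> at a singleton makes all products of odd
  length vanish.
\<close>

fun commutator_product :: "'a list \<Rightarrow> 'a" where
  "commutator_product [] = 1"
| "commutator_product [a] = 0"
| "commutator_product (a # b # w) = scale half (commutator a b) * commutator_product w"

text \<open>
  If \<open>p\<close> has even length, then \<open>a\<close> and \<open>b\<close> form one commutator; if it has odd length, they belong to
  two adjacent ones, and \<open>commutator_exchange\<close> applies, or both sides vanish when \<open>q\<close> is empty.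
\<close>

lemma commutator_product_swap: "commutator_product (p @ a # b # q) = - commutator_product (p @ b # a # q)"
proof (induction p rule: commutator_product.induct)
  case 1
  then show ?case
    by (simp add: commutator_swap[of b a])
next
  case (2 c)
  show ?case
  proof (cases q)
    case (Cons d q')
    then show ?thesis
      by (simp add: commutator_exchange[of c a b d]
          flip: scale_mult_left scale_mult_right mult.assoc)
  qed simp
qed auto

lemma commutator_product_move:
  "commutator_product (p @ a # v @ q) = scale ((- 1) ^ length v) (commutator_product (p @ v @ a # q))"
proof (induction v arbitrary: p)
  case (Cons c v)
  then show ?case
    using Cons[of "p @ [c]"] by (simp add: commutator_product_swap[of p a])
qed simp

lemma commutator_product_block_swap:
  "commutator_product (p @ u @ v @ q) = scale ((- 1) ^ (length u * length v)) (commutator_product (p @ v @ u @ q))"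
proof (induction u arbitrary: p)
  case (Cons a u)
  then show ?case
    using Cons[of "p @ [a]"] by (simp add: commutator_product_move[of p a v] power_add mult.commute)
qed simp

lemma foldr_jordan_left_commute: "foldr jordan u (jordan a t) = jordan a (foldr jordan u t)"
  by (induction u) (simp_all add: jordan_left_commute)

lemma foldr_jordan_commute: "foldr jordan u (foldr jordan v t) = foldr jordan v (foldr jordan u t)"
  by (induction u) (simp_all add: foldr_jordan_left_commute)

lemma foldr_jordan_scale: "foldr jordan u (scale c t) = scale c (foldr jordan u t)"
  by (induction u) (simp_all add: jordan_scale_right)

lemma foldr_jordan_mult_central:
  assumes "\<And>b. c * b = b * c"
  shows "foldr jordan u (c * t) = c * foldr jordan u t"
  by (induction u) (simp_all add: jordan_mult_central[OF assms])

text \<open>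
  The value at a word of the map \<open>\<Psi>\<close>, which reorders the word so that its even letters come
  before its odd ones.  For \<open>b i = x i\<close> this is the passage from even differential forms in the
  variables \<open>y i\<close>, with \<open>z i = d (y i)\<close>, to noncommuting operators.
\<close>

definition quantize :: "(nat \<Rightarrow> 'a) \<Rightarrow> (nat + nat) word \<Rightarrow> 'a" where
  "quantize b w = foldr jordan (map (b \<circ> projl) (filter isl (letters w)))
     (commutator_product (map (b \<circ> projr) (filter (\<lambda>x. \<not> isl x) (letters w))))"

lemma quantize_swap:
  "quantize b (p + u + v + q) = scale ((- 1) ^ (parity u * parity v)) (quantize b (p + v + u + q))"
proof -
  let ?E = "\<lambda>w. map (b \<circ> projl) (filter isl (letters w))"
  let ?O = "\<lambda>w. map (b \<circ> projr) (filter (\<lambda>x. \<not> isl x) (letters w))"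
  let ?s = "(- 1 :: 'c) ^ (length (?O u) * length (?O v))"
  have quantize: "quantize b w = foldr jordan (?E w) (commutator_product (?O w))" for w
    by (simp add: quantize_def)
  have E: "?E (w + w') = ?E w @ ?E w'" and O: "?O (w + w') = ?O w @ ?O w'" for w w'
    by (simp_all add: plus_word_def)
  have "commutator_product (?O (p + u + v + q)) = scale ?s (commutator_product (?O (p + v + u + q)))"
    unfolding O append_assoc by (rule commutator_product_block_swap)
  moreover have "foldr jordan (?E (p + u + v + q)) t = foldr jordan (?E (p + v + u + q)) t" for t
    unfolding E foldr_append o_apply append_assoc
    by (rule arg_cong[OF foldr_jordan_commute])
  ultimately have "quantize b (p + u + v + q) = scale ?s (quantize b (p + v + u + q))"
    by (simp only: quantize foldr_jordan_scale)
  also have "?s = (- 1) ^ (parity u * parity v)"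
    by (simp add: parity_def minus_one_power_iff)
  finally show ?thesis .
qed

text \<open>
  By multilinearity it suffices to consider monomials, where this is \<open>quantize_swap\<close>.
\<close>

lemma quantize_supercommutator:
  "linear_extension scale (quantize b) (g * supercommutator u v * h) = 0"
proof -
  let ?Q = "\<lambda>g u v h. linear_extension scale (quantize b) (g * supercommutator u v * h)"
  have parity_less: "parity w < 2" for w
    by (simp add: parity_def)
  have minus_one: "(- 1) ^ n * f = scale_pm ((- 1) ^ n) f"
    for n and f :: "(nat + nat) word \<Rightarrow>\<^sub>0 'c"
    by (simp add: minus_one_power_iff)
  show ?thesis
  proof (induction g rule: poly_mapping_additive_induct)
    case g: (single wg cg)
    show ?case
    proof (induction h rule: poly_mapping_additive_induct)
      case h: (single wh ch)
      show ?case
      proof (induction u rule: poly_mapping_additive_induct)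
        case u: (single wu cu)
        show ?case
        proof (induction v rule: poly_mapping_additive_induct)
          case v: (single wv cv)
          let ?sign = "(- 1) ^ (parity wu * parity wv) :: 'c"
          have comm: "supercommutator (Poly_Mapping.single wu cu) (Poly_Mapping.single wv cv)
              = Poly_Mapping.single (wu + wv) (cu * cv)
              - Poly_Mapping.single (wv + wu) (?sign * (cu * cv))"
            by (simp add: supercommutator_homogeneous[OF component_single component_single
                  parity_less parity_less] minus_one mult_single scale_pm_conv_mult mult.commute)
          have "linear_extension scale (quantize b)
              (Poly_Mapping.single wg cg *
                supercommutator (Poly_Mapping.single wu cu) (Poly_Mapping.single wv cv) *
                Poly_Mapping.single wh ch)
            = scale (cg * (cu * cv) * ch) (quantize b (wg + wu + wv + wh))
            - scale (cg * (?sign * (cu * cv)) * ch) (quantize b (wg + wv + wu + wh))"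
            unfolding comm
            by (simp add: left_diff_distrib right_diff_distrib mult_single add.assoc)
          also have "\<dots> = 0"
            unfolding quantize_swap[of b wg wu wv wh] by (simp add: ac_simps)
          finally show ?case .
        qed (simp_all add: supercommutator_add distrib_left distrib_right)
      qed (simp_all add: supercommutator_add distrib_left distrib_right)
    qed (simp_all add: distrib_left distrib_right)
  qed (simp_all add: distrib_left distrib_right)
qed

lemma quantize_supercomm_ideal:
  assumes "f \<in> supercomm_ideal"
  shows "linear_extension scale (quantize b) f = 0"
proof -
  let ?K = "{f. \<forall>g h. linear_extension scale (quantize b) (g * f * h) = 0}"
  have "algebra_ideal scale_pm ?K"
    unfolding algebra_ideal_def free_unital.subspace_def
  proof (intro conjI allI ballI impI)
    show "a * f \<in> ?K" "f * a \<in> ?K" if "f \<in> ?K" for a f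
    proof -
      show "a * f \<in> ?K"
        using that by (simp flip: mult.assoc)
      show "f * a \<in> ?K"
        using that by (simp add: mult.assoc)
    qed
  qed (simp_all add: distrib_left distrib_right
      flip: free_unital.scale_mult_left free_unital.scale_mult_right)
  then have "supercomm_ideal \<subseteq> ?K"
    unfolding supercomm_ideal_def
    by (intro hull_minimal) (auto simp: quantize_supercommutator)
  with assms have "f \<in> ?K" by blast
  then have "linear_extension scale (quantize b) (1 * f * 1) = 0" by blast
  then show ?thesis by simp
qed

lemma quantize_even:
  "linear_extension scale (quantize b) (even_generator i * f) = jordan (b i) (linear_extension scale (quantize b) f)"
proof (induction f rule: poly_mapping_additive_induct)
  case (single w c)
  show ?case
    by (simp add: mult_single quantize_def plus_word_def jordan_scale_right)
qed (simp_all add: distrib_left jordan_add_right)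

lemma quantize_odd_even:
  "linear_extension scale (quantize b) (odd_generator j * (even_generator i * f)) =
   linear_extension scale (quantize b) (even_generator i * (odd_generator j * f))"
proof (induction f rule: poly_mapping_additive_induct)
  case (single w c)
  show ?case
    by (simp add: mult_single quantize_def plus_word_def)
qed (simp_all add: distrib_left)

lemma quantize_odd_odd:
  "linear_extension scale (quantize b) (odd_generator j * (odd_generator i * f)) =
   scale half (commutator (b j) (b i)) * linear_extension scale (quantize b) f"
proof (induction f rule: poly_mapping_additive_induct)
  case (single w c)
  show ?case
    by (simp add: mult_single quantize_def plus_word_def scale_mult_right
        foldr_jordan_mult_central[OF half_commutator_central])
qed (simp_all add: distrib_left)

text \<open>
  Both statements are proved together by induction on the word.  When the first letter \<open>i\<close> is
  split off, \<open>y i\<close> contributes a Jordan product and \<open>z i\<close> half of a commutator by the second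
  statement, which add up to \<open>b i * \<dots>\<close>.  In the second statement, the summands \<open>z j y i\<close> and
  \<open>z j z i\<close> give the two terms of the Leibniz rule for \<open>[b j, b i * \<dots>]\<close>.
\<close>

lemma quantize_generic_product:
  shows "linear_extension scale (quantize b)
        (prod_list (map (\<lambda>i. even_generator i + odd_generator i) w))
      = prod_list (map b w)"
    and "linear_extension scale (quantize b)
        (odd_generator j * prod_list (map (\<lambda>i. even_generator i + odd_generator i) w))
      = scale half (commutator (b j) (prod_list (map b w)))"
proof (induction w arbitrary: j)
  case Nil
  {
    case 1
    show ?case
      by (simp add: quantize_def zero_word_def flip: single_one)
  next
    case 2
    show ?case
      by (simp add: quantize_def commutator_def)
  }
next
  case (Cons i w)
  {
    case 1
    show ?case
      using jordan_add_commutator[of "b i" "prod_list (map b w)"]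
      by (simp add: distrib_right quantize_even Cons)
  next
    case 2
    show ?case
      by (simp add: distrib_right distrib_left quantize_even quantize_odd_even quantize_odd_odd Cons
          jordan_central[OF half_commutator_central] commutator_mult_right scale_right_distrib
          add.commute flip: scale_mult_left scale_mult_right)
  }
qed

lemma word_value_eq_prod_list:
  "w \<noteq> [] \<Longrightarrow> word_value (b :: 'x \<Rightarrow> 'd::{ring, monoid_mult}) w = prod_list (map b w)"
  by (induction b w rule: word_value.induct) simp_all

lemma satisfies_identities_free_supercomm:
  assumes "f \<in> identities (scale_supercomm :: 'c \<Rightarrow> _)"
  shows "evaluate scale b f = 0"
proof -
  \<comment> \<open>Evaluating at these elements of \<open>S\<close> alone suffices: they are generic.\<close>
  let ?g = "\<lambda>i. even_generator i + odd_generator i"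
  have "abs_free_supercomm (evaluate scale_pm ?g f)
      = evaluate scale_supercomm (abs_free_supercomm \<circ> ?g) f"
    by (rule algebra_hom.hom_evaluate[OF algebra_hom_abs_free_supercomm])
  also have "\<dots> = 0"
    using assms by (simp add: identities_def)
  finally have "linear_extension scale (quantize b) (evaluate scale_pm ?g f) = 0"
    by (simp add: abs_free_supercomm_eq_0_iff quantize_supercomm_ideal)
  moreover have "linear_extension scale (quantize b) (evaluate scale_pm ?g f) = evaluate scale b f"
    unfolding evaluate_def linear_extension_sum
  proof (intro sum.cong refl)
    fix w assume "w \<in> Poly_Mapping.keys (poly_of f)"
    then have "letters w \<noteq> []"
      using poly_of[of f] by (cases w) (auto simp: in_keys_iff zero_word_def)
    then show "linear_extension scale (quantize b)
          (scale_pm (Poly_Mapping.lookup (poly_of f) w) (word_value ?g (letters w)))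
        = scale (Poly_Mapping.lookup (poly_of f) w) (word_value b (letters w))"
      by (simp add: word_value_eq_prod_list quantize_generic_product)
  qed
  ultimately show ?thesis by simp
qed

end


section \<open>The relatively free Grassmann algebra\<close>

text \<open>
  The ideal of the free \<^emph>\<open>unital\<close> algebra.  All triple commutators are taken as generators, and not
  those of letters alone, so that the Grassmann identity holds for all elements of the quotient.
\<close>

definition grassmann_ideal :: "(nat word \<Rightarrow>\<^sub>0 'c::comm_ring_1) set" where
  "grassmann_ideal = algebra_ideal scale_pm hull {commutator a (commutator b c) | a b c. True}"

lemma algebra_ideal_grassmann_ideal: "algebra_ideal scale_pm grassmann_ideal"
  unfolding grassmann_ideal_def
  by (rule hull_in) (auto simp: algebra_ideal_def free_unital.subspace_def)

lemma grassmann_ideal_0: "0 \<in> grassmann_ideal"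
  and grassmann_ideal_add:
    "f \<in> grassmann_ideal \<Longrightarrow> g \<in> grassmann_ideal \<Longrightarrow> f + g \<in> grassmann_ideal"
  and grassmann_ideal_scale: "f \<in> grassmann_ideal \<Longrightarrow> scale_pm c f \<in> grassmann_ideal"
  and grassmann_ideal_mult_left: "f \<in> grassmann_ideal \<Longrightarrow> h * f \<in> grassmann_ideal"
  and grassmann_ideal_mult_right: "f \<in> grassmann_ideal \<Longrightarrow> f * h \<in> grassmann_ideal"
  using algebra_ideal_grassmann_ideal
  by (auto simp: algebra_ideal_def free_unital.subspace_def)

lemma grassmann_ideal_uminus: "f \<in> grassmann_ideal \<Longrightarrow> - f \<in> grassmann_ideal"
  using grassmann_ideal_mult_left[of f "-1"] by simp

lemma grassmann_ideal_diff:
  "f \<in> grassmann_ideal \<Longrightarrow> g \<in> grassmann_ideal \<Longrightarrow> f - g \<in> grassmann_ideal"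
  using grassmann_ideal_add[OF _ grassmann_ideal_uminus, of f g] by simp

quotient_type (overloaded) 'c free_grassmann =
  "nat word \<Rightarrow>\<^sub>0 'c::comm_ring_1" / "\<lambda>f g. f - g \<in> grassmann_ideal"
proof (rule equivpI)
  show "reflp (\<lambda>f g :: nat word \<Rightarrow>\<^sub>0 'c. f - g \<in> grassmann_ideal)"
    by (simp add: reflp_def grassmann_ideal_0)
  show "symp (\<lambda>f g :: nat word \<Rightarrow>\<^sub>0 'c. f - g \<in> grassmann_ideal)"
    by (auto simp: symp_def dest: grassmann_ideal_uminus)
  show "transp (\<lambda>f g :: nat word \<Rightarrow>\<^sub>0 'c. f - g \<in> grassmann_ideal)"
    by (auto simp: transp_def dest: grassmann_ideal_add)
qed

instantiation free_grassmann :: (comm_ring_1) "{ring, monoid_mult}"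
begin

lift_definition zero_free_grassmann :: "'a free_grassmann" is 0 .

lift_definition one_free_grassmann :: "'a free_grassmann" is 1 .

lift_definition plus_free_grassmann ::
  "'a free_grassmann \<Rightarrow> 'a free_grassmann \<Rightarrow> 'a free_grassmann" is "(+)"
  using grassmann_ideal_add by (metis add_diff_add)

lift_definition minus_free_grassmann ::
  "'a free_grassmann \<Rightarrow> 'a free_grassmann \<Rightarrow> 'a free_grassmann" is "(-)"
  subgoal for f f' g g'
    using grassmann_ideal_diff[of "f - f'" "g - g'"] by (simp add: algebra_simps)
  done

lift_definition uminus_free_grassmann :: "'a free_grassmann \<Rightarrow> 'a free_grassmann" is uminus
  subgoal for f f'
    using grassmann_ideal_uminus[of "f - f'"] by simp
  done

lift_definition times_free_grassmann ::
  "'a free_grassmann \<Rightarrow> 'a free_grassmann \<Rightarrow> 'a free_grassmann" is "(*)"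
  subgoal for f f' g g'
    using grassmann_ideal_add[OF grassmann_ideal_mult_right[of "f - f'" g]
        grassmann_ideal_mult_left[of "g - g'" f']]
    by (simp add: algebra_simps)
  done

instance
  by standard (transfer; simp add: grassmann_ideal_0 algebra_simps; fail)+

end

lift_definition scale_grassmann ::
  "'c::comm_ring_1 \<Rightarrow> 'c free_grassmann \<Rightarrow> 'c free_grassmann" is scale_pm
  subgoal for c f f'
    using grassmann_ideal_scale[of "f - f'" c] by (simp only: free_unital.scale_right_diff_distrib)
  done

lemma grassmann_algebra_free_grassmann:
  assumes "half + half = (1 :: 'c::comm_ring_1)"
  shows "grassmann_algebra (scale_grassmann :: 'c \<Rightarrow> _) half"
proof
  fix c d :: 'c and a b e :: "'c free_grassmann"
  show "scale_grassmann c (a + b) = scale_grassmann c a + scale_grassmann c b"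
    by transfer (simp add: free_unital.scale_right_distrib grassmann_ideal_0)
  show "scale_grassmann (c + d) a = scale_grassmann c a + scale_grassmann d a"
    by transfer (simp add: free_unital.scale_left_distrib grassmann_ideal_0)
  show "scale_grassmann c (scale_grassmann d a) = scale_grassmann (c * d) a"
    by transfer (simp add: grassmann_ideal_0)
  show "scale_grassmann 1 a = a"
    by transfer (simp add: grassmann_ideal_0)
  show "scale_grassmann c (a * b) = scale_grassmann c a * b"
    by transfer (simp add: free_unital.scale_mult_left grassmann_ideal_0)
  show "scale_grassmann c (a * b) = a * scale_grassmann c b"
    by transfer (simp add: free_unital.scale_mult_right grassmann_ideal_0)
  show "commutator a (commutator b e) = 0"
    unfolding commutator_def
  proof (transfer, fold commutator_def)
    fix a b e :: "nat word \<Rightarrow>\<^sub>0 'c"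
    show "commutator a (commutator b e) - 0 \<in> grassmann_ideal"
      unfolding grassmann_ideal_def diff_0_right by (rule hull_inc) auto
  qed
qed (rule assms)

lemma poly_of_identity_in_grassmann_ideal:
  assumes "(2 :: 'c::comm_ring_1) dvd 1"
    and "f \<in> identities (scale_supercomm :: 'c \<Rightarrow> _)"
  shows "poly_of f \<in> grassmann_ideal"
proof -
  obtain half :: 'c where "half + half = 1"
    using assms(1) by (auto simp: dvd_def)
  then interpret grassmann_algebra "scale_grassmann :: 'c \<Rightarrow> _" half
    by (rule grassmann_algebra_free_grassmann)
  have "algebra_hom scale_pm (scale_grassmann :: 'c \<Rightarrow> _) abs_free_grassmann"
    by unfold_locales
      (simp_all add: plus_free_grassmann.abs_eq scale_grassmann.abs_eq times_free_grassmann.abs_eq)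
  from algebra_hom.hom_evaluate[OF this, of "poly_of \<circ> letter" f]
  have "abs_free_grassmann (poly_of f) = 0"
    by (simp add: poly_of_eq_evaluate satisfies_identities_free_supercomm[OF assms(2)])
  then show ?thesis
    by (simp add: zero_free_grassmann_def free_grassmann.abs_eq_iff)
qed


section \<open>The T-ideal generated by the Grassmann identity\<close>

lemma T_ideal_hull: "T_ideal (T_ideal hull S :: (nat, 'c::comm_ring_1) free_algebra set)"
proof (rule hull_in)
  show "T_ideal (\<Inter> \<T>)" if T: "\<forall>T\<in>\<T>. T_ideal T" for \<T> :: "(nat, 'c::comm_ring_1) free_algebra set set"
    unfolding T_ideal_def
  proof (intro conjI allI impI)
    show "algebra_ideal scale_free (\<Inter> \<T>)"
      using T by (auto simp: T_ideal_def algebra_ideal_def free_algebra.subspace_def)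
    show "\<phi> ` (\<Inter> \<T>) \<subseteq> \<Inter> \<T>" if "algebra_hom scale_free scale_free \<phi>" for \<phi>
      using T that unfolding T_ideal_def by blast
  qed
qed

text \<open>
  Since the three letters are distinct, some endomorphism sends them to \<open>a\<close>, \<open>b\<close>, \<open>c\<close>.
\<close>

lemma commutator_in_T_ideal:
  fixes T :: "(nat, 'c::comm_ring_1) free_algebra set"
  assumes "T_ideal T" and "distinct [x, y, z]"
    and "commutator (letter x) (commutator (letter y) (letter z)) \<in> T"
  shows "commutator a (commutator b c) \<in> T"
proof -
  let ?\<phi> = "evaluate scale_free (\<lambda>i. if i = x then a else if i = y then b else c)"
  interpret hom: algebra_hom scale_free scale_free ?\<phi>
    by (rule free_algebra.algebra_hom_evaluate)
  have "?\<phi> (commutator (letter x) (commutator (letter y) (letter z))) \<in> T"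
    using assms hom.algebra_hom_axioms unfolding T_ideal_def by blast
  then show ?thesis
    using assms(2) by (simp add: hom.hom_commutator)
qed

lemma constant_plus_poly_of:
  obtains c g where "p = Poly_Mapping.single 0 c + poly_of g"
proof
  show "p = Poly_Mapping.single 0 (Poly_Mapping.lookup p 0)
      + poly_of (Free (p - Poly_Mapping.single 0 (Poly_Mapping.lookup p 0)))"
    by (subst Free_inverse) (simp_all add: lookup_minus)
qed

text \<open>
  An ideal of the algebra without unit is closed under scalars, hence it remains an ideal after a
  unit is adjoined.
\<close>

lemma algebra_ideal_poly_of_image:
  fixes T :: "('x, 'c::comm_ring_1) free_algebra set"
  assumes "algebra_ideal scale_free T"
  shows "algebra_ideal scale_pm (poly_of ` T)"
proof -
  have T: "0 \<in> T" "\<And>f g. f \<in> T \<Longrightarrow> g \<in> T \<Longrightarrow> f + g \<in> T" "\<And>c f. f \<in> T \<Longrightarrow> scale_free c f \<in> T"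
    "\<And>f g. f \<in> T \<Longrightarrow> g * f \<in> T" "\<And>f g. f \<in> T \<Longrightarrow> f * g \<in> T"
    using assms by (auto simp: algebra_ideal_def free_algebra.subspace_def)
  show ?thesis
    unfolding algebra_ideal_def free_unital.subspace_def
  proof (intro conjI allI ballI impI)
    show "0 \<in> poly_of ` T"
      using T(1) by (metis image_eqI zero_free_algebra.rep_eq)
    show "f + g \<in> poly_of ` T" if "f \<in> poly_of ` T" "g \<in> poly_of ` T" for f g
      using that T(2) by (auto simp flip: plus_free_algebra.rep_eq)
    show "scale_pm c f \<in> poly_of ` T" if "f \<in> poly_of ` T" for c f
      using that T(3) by (auto simp flip: scale_free.rep_eq)
  next
    fix p f :: "'x word \<Rightarrow>\<^sub>0 'c" assume "f \<in> poly_of ` T"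
    then obtain t where t: "t \<in> T" "f = poly_of t" by blast
    obtain c g where p: "p = Poly_Mapping.single 0 c + poly_of g"
      by (rule constant_plus_poly_of)
    have "p * f = poly_of (scale_free c t + g * t)"
      by (simp add: p t distrib_right plus_free_algebra.rep_eq scale_free.rep_eq
          times_free_algebra.rep_eq scale_pm_conv_mult)
    then show "p * f \<in> poly_of ` T"
      using T t by blast
    have "f * p = poly_of (scale_free c t + t * g)"
      by (simp add: p t distrib_left plus_free_algebra.rep_eq scale_free.rep_eq
          times_free_algebra.rep_eq scale_pm_conv_mult mult_single_0_commute)
    then show "f * p \<in> poly_of ` T"
      using T t by blast
  qed
qed

text \<open>
  Constant terms are central and do not affect commutators, so a triple commutator in the unital
  algebra is one of polynomials without constant term.
\<close>

lemma grassmann_ideal_subset_poly_of_image: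
  fixes T :: "(nat, 'c::comm_ring_1) free_algebra set"
  assumes "algebra_ideal scale_free T" and "\<And>a b c. commutator a (commutator b c) \<in> T"
  shows "grassmann_ideal \<subseteq> poly_of ` T"
proof -
  have drop_constant: "commutator (Poly_Mapping.single 0 c + f) g = commutator f g"
    "commutator g (Poly_Mapping.single 0 c + f) = commutator g f"
    for c and f g :: "nat word \<Rightarrow>\<^sub>0 'c"
    by (simp_all add: commutator_def distrib_left distrib_right mult_single_0_commute)
  have "commutator p (commutator q r) \<in> poly_of ` T" for p q r
  proof -
    obtain c1 f where p: "p = Poly_Mapping.single 0 c1 + poly_of f"
      by (rule constant_plus_poly_of)
    obtain c2 g where q: "q = Poly_Mapping.single 0 c2 + poly_of g"
      by (rule constant_plus_poly_of)
    obtain c3 h where r: "r = Poly_Mapping.single 0 c3 + poly_of h"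
      by (rule constant_plus_poly_of)
    have "commutator p (commutator q r) = poly_of (commutator f (commutator g h))"
      unfolding p q r drop_constant
      by (simp add: algebra_hom.hom_commutator[OF algebra_hom_poly_of])
    then show ?thesis
      using assms(2) by blast
  qed
  then show ?thesis
    unfolding grassmann_ideal_def
    by (intro hull_minimal algebra_ideal_poly_of_image assms(1)) auto
qed

theorem corollary1p8:
  fixes x y z :: nat
  assumes "(2 :: 'c::comm_ring_1) dvd 1"
    and "distinct [x, y, z]"
  shows "identities (scale_supercomm :: 'c \<Rightarrow> 'c free_supercomm \<Rightarrow> 'c free_supercomm) =
    T_ideal hull {commutator (letter x) (commutator (letter y) (letter z))}"
    (is "?id = ?T")
proof
  have T: "T_ideal ?T"
    by (rule T_ideal_hull)
  have "commutator a (commutator b c) \<in> ?T" for a b c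
    by (rule commutator_in_T_ideal[OF T assms(2)]) (simp add: hull_inc)
  with T have "grassmann_ideal \<subseteq> poly_of ` ?T"
    by (intro grassmann_ideal_subset_poly_of_image) (simp_all add: T_ideal_def)
  then show "?id \<subseteq> ?T"
    using poly_of_identity_in_grassmann_ideal[OF assms(1)] by (force simp: poly_of_inject)
next
  interpret ev: algebra_hom scale_free "scale_supercomm :: 'c \<Rightarrow> _" "evaluate scale_supercomm b" for b
    by (rule free_supercomm.algebra_hom_evaluate)
  have "commutator (letter x) (commutator (letter y) (letter z)) \<in> ?id"
    by (simp add: identities_def ev.hom_commutator grassmann_identity_free_supercomm)
  then show "?T \<subseteq> ?id"
    by (intro hull_minimal free_supercomm.T_ideal_identities) simp
qed

end
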